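(* Let $\mathcal{A}$ be a Rickart *-ring and let $a,b\in\mathcal{A}$ be core invertible. Then $a\leq^{\oplus} b$ (core partial order) if and only if $a\preceq^{\ell*|r\square} b$, that is, if and only if $\mathrm{lp}(a)b=a=\mathrm{lp}(b)a$ and $a^2=ba$.
   Context: A *-ring is an (associative) ring $\mathcal{A}$ with an involution $*$: $(a+b)^*=a^*+b^*$, $(ab)^*=b^*a^*$, $(a^* )^*=a$. It is a Rickart *-ring if for every $a\in\mathcal{A}$ there is a self-adjoint idempotent $p$ (i.e. $p=p^*=p^2$) with $\{x\in\mathcal{A}: xa=0\}=\mathcal{A}(1-p)$; such a ring has an identity $1$, and $p$ is unique and denoted $\mathrm{lp}(a)$. An element $a\in\mathcal{A}$ is core invertible if there is $a^{\oplus}\in\mathcal{A}$ with $aa^{\oplus}a=a$, $a^{\oplus}\mathcal{A}=a\mathcal{A}$ and $\mathcal{A}a^{\oplus}=\mathcal{A}a^*$; such $a^{\oplus}$ is unique and called the core inverse of $a$. For core invertible $a,b$, the core partial order is defined by: $a\leq^{\oplus}b$ iff $a^{\oplus}a=a^{\oplus}b$ and $aa^{\oplus}=ba^{\oplus}$. *)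

theory Defs
  imports Main
begin

text \<open>
  The sort is \<open>ring + monoid_mult\<close> and not \<^class>\<open>ring_1\<close>, since \<^class>\<open>ring_1\<close> would exclude the
  zero ring.
\<close>

class star_ring = ring + monoid_mult +
  fixes star :: "'a \<Rightarrow> 'a"
  assumes star_add: "star (a + b) = star a + star b"
    and star_mult: "star (a * b) = star b * star a"
    and star_star: "star (star a) = a"

definition (in star_ring) right_ideal_gen :: "'a \<Rightarrow> 'a set" where
  "right_ideal_gen a = {a * x | x. True}"

definition (in star_ring) left_ideal_gen :: "'a \<Rightarrow> 'a set" where
  "left_ideal_gen a = {x * a | x. True}"

definition (in star_ring) projection :: "'a \<Rightarrow> bool" where
  "projection p \<longleftrightarrow> star p = p \<and> p * p = p"

definition (in star_ring) is_lp :: "'a \<Rightarrow> 'a \<Rightarrow> bool" where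
  "is_lp a p \<longleftrightarrow> projection p \<and> {x. x * a = 0} = left_ideal_gen (1 - p)"

class rickart_star_ring = star_ring +
  assumes rickart: "\<exists>p. is_lp a p"

definition lp :: "'a::rickart_star_ring \<Rightarrow> 'a" where
  "lp a = (THE p. is_lp a p)"

definition is_core_inverse :: "'a::star_ring \<Rightarrow> 'a \<Rightarrow> bool" where
  "is_core_inverse a x \<longleftrightarrow>
     a * x * a = a \<and>
     right_ideal_gen x = right_ideal_gen a \<and>
     left_ideal_gen x = left_ideal_gen (star a)"

definition core_invertible :: "'a::star_ring \<Rightarrow> bool" where
  "core_invertible a \<longleftrightarrow> (\<exists>x. is_core_inverse a x)"

definition core_inverse :: "'a::star_ring \<Rightarrow> 'a" where
  "core_inverse a = (THE x. is_core_inverse a x)"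

text \<open>The core partial order; meaningful only for core invertible arguments.\<close>

definition core_le :: "'a::star_ring \<Rightarrow> 'a \<Rightarrow> bool" where
  "core_le a b \<longleftrightarrow>
     core_inverse a * a = core_inverse a * b \<and>
     a * core_inverse a = b * core_inverse a"

text \<open>The relation $\preceq^{\ell*|r\square}$.\<close>

definition lstar_rbox_le :: "'a::rickart_star_ring \<Rightarrow> 'a \<Rightarrow> bool" where
  "lstar_rbox_le a b \<longleftrightarrow> lp a * b = a \<and> a = lp b * a \<and> a\<^sup>2 = b * a"

text \<open>The definite descriptions in \<^const>\<open>lp\<close> and \<^const>\<open>core_inverse\<close> are well defined.\<close>

lemma is_lp_unique:
  assumes "is_lp a p" "is_lp a q"
  shows "p = q"
proof -
  have *: "r = s * r" if r: "is_lp a r" and s: "is_lp a s" for r s :: 'a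
  proof -
    have "1 - s \<in> left_ideal_gen (1 - r)"
      using r s unfolding is_lp_def left_ideal_gen_def by (metis (mono_tags, lifting) mem_Collect_eq mult_1)
    then obtain z where "1 - s = z * (1 - r)"
      unfolding left_ideal_gen_def by auto
    then have "(1 - s) * r = z * ((1 - r) * r)"
      by (simp add: mult.assoc)
    also have "(1 - r) * r = 0"
      using r by (simp add: is_lp_def projection_def left_diff_distrib)
    finally show ?thesis
      by (simp add: left_diff_distrib)
  qed
  have "p = star (q * p)"
    using *[OF assms] assms(1) by (simp add: is_lp_def projection_def)
  also have "\<dots> = p * q"
    using assms by (simp add: is_lp_def projection_def star_mult)
  finally show ?thesis
    using *[OF assms(2,1)] by simp
qed

lemma is_lp_lp: "is_lp a (lp a)"
proof -
  obtain p where "is_lp a p"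
    using rickart[of a] by blast
  then show ?thesis
    unfolding lp_def by (rule theI) (rule is_lp_unique[OF _ \<open>is_lp a p\<close>])
qed

lemma is_core_inverse_facts:
  assumes "is_core_inverse a x"
  shows "a * x * a = a" "star (a * x) = a * x" "x * a * x = x" "a * x * x = x" "x * a * a = a"
proof -
  show axa: "a * x * a = a"
    using assms by (simp add: is_core_inverse_def)
  have R: "right_ideal_gen x = right_ideal_gen a"
    and L: "left_ideal_gen x = left_ideal_gen (star a)"
    using assms by (simp_all add: is_core_inverse_def)
  have "x \<in> right_ideal_gen x" "a \<in> right_ideal_gen a" "x \<in> left_ideal_gen x"
    unfolding right_ideal_gen_def left_ideal_gen_def by (metis (mono_tags, lifting) mem_Collect_eq mult_1 mult_1_right)+
  then obtain y v w where y: "x = a * y" and v: "a = x * v" and w: "x = w * star a"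
    using R L unfolding right_ideal_gen_def left_ideal_gen_def by blast
  show axx: "a * x * x = x"
    using axa y by (metis mult.assoc)
  have "star a = star a * star (a * x)"
    using arg_cong[OF axa, of star] by (simp add: star_mult mult.assoc)
  then have xs: "x = x * star (a * x)"
    using w by (metis mult.assoc)
  then have h: "a * x = (a * x) * star (a * x)"
    by (metis mult.assoc)
  then show s: "star (a * x) = a * x"
    by (metis star_mult star_star)
  then show xax: "x * a * x = x"
    using xs by (simp add: mult.assoc)
  then show "x * a * a = a"
    using v by (metis mult.assoc)
qed

lemma is_core_inverse_unique:
  assumes x: "is_core_inverse a x" and y: "is_core_inverse a y"
  shows "x = y"
proof -
  note X = is_core_inverse_facts[OF x] and Y = is_core_inverse_facts[OF y]
  have 1: "a * x = (a * y) * (a * x)"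
    using Y(1) by (metis mult.assoc)
  have 2: "a * y = (a * x) * (a * y)"
    using X(1) by (metis mult.assoc)
  have "a * x = (a * x) * (a * y)"
    using arg_cong[OF 1, of star] X(2) Y(2) by (simp only: star_mult[of "a * y" "a * x"])
  then have "a * x = a * y"
    using 2 by simp
  then have "y = y * (a * x)"
    using Y(3) by (simp add: mult.assoc)
  also have "\<dots> = y * a * (a * x * x)"
    using X(4) by (simp add: mult.assoc)
  also have "\<dots> = (y * a * a) * x * x"
    by (simp only: mult.assoc)
  also have "\<dots> = x"
    using X(4) Y(5) by simp
  finally show ?thesis
    by simp
qed

lemma is_core_inverse_core_inverse:
  assumes "core_invertible a"
  shows "is_core_inverse a (core_inverse a)"
proof -
  obtain x where "is_core_inverse a x"
    using assms core_invertible_def by blast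
  then show ?thesis
    unfolding core_inverse_def by (rule theI) (rule is_core_inverse_unique[OF _ \<open>is_core_inverse a x\<close>])
qed

end

theory Submission
  imports Defs
begin

text \<open>If \<open>x\<close> is the core inverse of \<open>a\<close>, then
  \<open>lp a = a * x\<close> (\<open>lp_core_inverse\<close>), so both relations become equations
  in \<open>a\<close>, \<open>b\<close> and the core inverses. Multiplying on the left by
  \<open>a\<close> or \<open>x\<close> exchanges \<open>x * a = x * b\<close> and
  \<open>a * x * b = a\<close>; multiplying on the right by \<open>a * a\<close> or
  \<open>x * x\<close> exchanges \<open>a * x = b * x\<close> and
  \<open>a * a = b * a\<close>.\<close>

lemma lp_core_inverse:
  fixes a :: "'a::rickart_star_ring"
  assumes "is_core_inverse a x"
  shows "lp a = a * x"
proof -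
  note X = is_core_inverse_facts[OF assms]
  have "projection (a * x)"
    using X(1,2) by (simp add: projection_def flip: mult.assoc)
  moreover have "z * a = 0 \<longleftrightarrow> (\<exists>w. z = w * (1 - a * x))" for z
  proof
    assume "z * a = 0"
    \<comment> \<open>The witness is \<open>z\<close> itself, as \<open>z * a = 0\<close> kills
      \<open>z * a * x\<close>.\<close>
    then have "z = z * (1 - a * x)"
      by (simp add: right_diff_distrib flip: mult.assoc)
    then show "\<exists>w. z = w * (1 - a * x)" ..
  next
    assume "\<exists>w. z = w * (1 - a * x)"
    then show "z * a = 0"
      using X(1) by (auto simp: mult.assoc left_diff_distrib)
  qed
  ultimately have "is_lp a (a * x)"
    by (auto simp: is_lp_def left_ideal_gen_def)
  then show ?thesis
    by (rule is_lp_unique[OF is_lp_lp])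
qed

theorem mainTheorem18:
  fixes a b :: "'a::rickart_star_ring"
  assumes "core_invertible a" and "core_invertible b"
  shows "core_le a b \<longleftrightarrow> lstar_rbox_le a b"
proof -
  define x y where "x = core_inverse a" and "y = core_inverse b"
  have x: "is_core_inverse a x" and y: "is_core_inverse b y"
    unfolding x_def y_def using assms by (simp_all add: is_core_inverse_core_inverse)
  note X = is_core_inverse_facts[OF x] and Y = is_core_inverse_facts[OF y]
  have "x * a = x * b \<and> a * x = b * x \<longleftrightarrow>
        a * x * b = a \<and> a = b * y * a \<and> a * a = b * a"
  proof (intro iffI conjI; elim conjE)
    assume xa: "x * a = x * b" and ax: "a * x = b * x"
    show "a * x * b = a"
      using X(1) xa by (simp add: mult.assoc)
    \<comment> \<open>This puts \<open>a\<close> in the right ideal of \<open>b\<close>, which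
      \<open>b * y\<close> fixes from the left.\<close>
    have "a = b * (x * a)"
      using X(1) ax by (simp flip: mult.assoc)
    then show "a = b * y * a"
      using Y(1) by (metis mult.assoc)
    show "a * a = b * a"
      using X(5) ax by (metis mult.assoc)
  next
    assume axb: "a * x * b = a" and aa: "a * a = b * a"
    show "x * a = x * b"
      using X(3) axb by (metis mult.assoc)
    \<comment> \<open>Replace \<open>x\<close> by \<open>a * x * x\<close> on both sides, so that
      \<open>a * a\<close> and \<open>b * a\<close> appear.\<close>
    show "a * x = b * x"
      using X(4) aa by (metis mult.assoc)
  qed
  then show ?thesis
    unfolding core_le_def lstar_rbox_le_def lp_core_inverse[OF x] lp_core_inverse[OF y]
      x_def[symmetric] power2_eq_square .
qed

end
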